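(* For all $n,m\ge 1$ there exists a homogeneous-goods market with $n$ buyers and $m$ sellers for which the Price of Anarchy (with an unregulated revenue-maximizing platform) is $H_{\min\{n,m\}}=\Omega(\log(\min\{n,m\}))$, where $H_k=1+\tfrac12+\dots+\tfrac1k$.
   Context: A homogeneous-goods market $(S,B,\mathbf v,G)$ consists of a finite set $B$ of $n$ buyers, a finite set $S$ of $m$ sellers (each owning one item), a value $v_i\ge 0$ for each buyer $i$ (the buyer's value for any single item, each buyer wanting at most one item), and a bipartite graph $G$ between $B$ and $S$ whose edges are the pairs that can transact directly. $W(S',B',G)$ denotes the maximum total value of matched buyers over matchings between $B'\subseteq B$ and $S'\subseteq S$ that use only edges of $G$. The optimal welfare $W^\star$ is $W(S,B,K)$ where $K$ is the complete bipartite graph between $B$ and $S$. For a set $P\subseteq S$ of sellers joining the platform, $G(P)$ is obtained from $G$ by adding all edges between $P$ and $B$. The market clears at the maximum competitive (Walrasian) equilibrium prices with respect to $G(P)$, which equal $p_j(P)=W(S,B,G(P))-W(S\setminus\{j\},B,G(P))$, and the resulting social welfare is $W(S,B,G(P))$. At fee $\alpha\in[0,1]$, seller $j$ has utility $u_j(P,\alpha)=(1-\alpha)p_j(P)$ if $j\in P$ and $u_j(P,\alpha)=p_j(P)$ if $j\notin P$. A vector $\mathbf x=(x_j)_{j\in S}\in[0,1]^S$ denotes the profile where each seller $j$ independently joins with probability $x_j$; $P\sim\mathbf x$ is the resulting random set, and $P\sim\mathbf x_{-j}$ the random set of joining sellers other than $j$. $\mathbf x$ is a Platform Equilibrium at fee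 $\alpha$ if for every $j$, $\mathbb E_{P\sim\mathbf x}[u_j(P,\alpha)]\ge\max\{\mathbb E_{P\sim\mathbf x_{-j}}[u_j(P,\alpha)],\mathbb E_{P\sim\mathbf x_{-j}}[u_j(P\cup\{j\},\alpha)]\}$. Let $\mathrm{EQ}(\alpha)$ be the set of all Platform Equilibria at fee $\alpha$. The platform's revenue at $(\alpha,\mathbf x)$ is $\mathbb E_{P\sim\mathbf x}[\alpha\sum_{j\in P}p_j(P)]$. A revenue-maximizing fee is $\alpha^\star\in\arg\max_{\alpha\in[0,1]}\max_{\mathbf x\in\mathrm{EQ}(\alpha)}\mathbb E_{P\sim\mathbf x}[\alpha\sum_{j\in P}p_j(P)]$, and $\mathbf X^\star$ is the set of equilibria in $\mathrm{EQ}(\alpha^\star)$ that attain the maximal revenue. The Price of Anarchy of the market is $\max_{\mathbf x\in\mathbf X^\star}W^\star/\mathbb E_{P\sim\mathbf x}[W(S,B,G(P))]$, i.e. the ratio for the lowest-welfare revenue-maximizing equilibrium. *)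

theory Defs
  imports "HOL-Probability.Probability"
begin

record ('b, 's) market =
  buyers :: "'b set"
  sellers :: "'s set"
  val :: "'b \<Rightarrow> real"
  edges :: "('b \<times> 's) set"

definition homogeneous_market :: "('b, 's) market \<Rightarrow> bool" where
  "homogeneous_market M \<longleftrightarrow>
     finite (buyers M) \<and> finite (sellers M) \<and>
     (\<forall>i\<in>buyers M. 0 \<le> val M i) \<and>
     edges M \<subseteq> buyers M \<times> sellers M"

definition is_matching :: "('b \<times> 's) set \<Rightarrow> bool" where
  "is_matching F \<longleftrightarrow> inj_on fst F \<and> inj_on snd F"

definition max_welfare ::
    "('b, 's) market \<Rightarrow> 's set \<Rightarrow> 'b set \<Rightarrow> ('b \<times> 's) set \<Rightarrow> real" where
  "max_welfare M S' B' E =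
     Max ((\<lambda>F. \<Sum>e\<in>F. val M (fst e)) ` {F. F \<subseteq> E \<inter> (B' \<times> S') \<and> is_matching F})"

definition optimal_welfare :: "('b, 's) market \<Rightarrow> real" where
  "optimal_welfare M = max_welfare M (sellers M) (buyers M) (buyers M \<times> sellers M)"

definition platform_edges :: "('b, 's) market \<Rightarrow> 's set \<Rightarrow> ('b \<times> 's) set" where
  "platform_edges M P = edges M \<union> buyers M \<times> P"

definition welfare :: "('b, 's) market \<Rightarrow> 's set \<Rightarrow> real" where
  "welfare M P = max_welfare M (sellers M) (buyers M) (platform_edges M P)"

text \<open>The maximum competitive price of an item is the marginal contribution of its seller
  to the optimal welfare on the graph with platform edges.\<close>

definition price :: "('b, 's) market \<Rightarrow> 's set \<Rightarrow> 's \<Rightarrow> real" where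
  "price M P j = welfare M P
     - max_welfare M (sellers M - {j}) (buyers M) (platform_edges M P)"

definition utility :: "('b, 's) market \<Rightarrow> real \<Rightarrow> 's \<Rightarrow> 's set \<Rightarrow> real" where
  "utility M \<alpha> j P = (if j \<in> P then (1 - \<alpha>) * price M P j else price M P j)"

text \<open>The random set of those sellers in \<open>A\<close> who join, each \<open>j\<close> independently with
  probability \<open>x j\<close>; \<open>A\<close> is the set of all sellers, or all sellers but one.\<close>

definition joining_pmf :: "'s set \<Rightarrow> ('s \<Rightarrow> real) \<Rightarrow> 's set pmf" where
  "joining_pmf A x = map_pmf (\<lambda>f. {j. f j}) (Pi_pmf A False (\<lambda>j. bernoulli_pmf (x j)))"

definition platform_equilibria :: "('b, 's) market \<Rightarrow> real \<Rightarrow> ('s \<Rightarrow> real) set" where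
  "platform_equilibria M \<alpha> =
     {x \<in> sellers M \<rightarrow>\<^sub>E {0..1}. \<forall>j\<in>sellers M.
        measure_pmf.expectation (joining_pmf (sellers M) x) (utility M \<alpha> j)
        \<ge> max (measure_pmf.expectation (joining_pmf (sellers M - {j}) x) (utility M \<alpha> j))
              (measure_pmf.expectation (joining_pmf (sellers M - {j}) x)
                 (\<lambda>P. utility M \<alpha> j (insert j P)))}"

definition revenue :: "('b, 's) market \<Rightarrow> real \<Rightarrow> ('s \<Rightarrow> real) \<Rightarrow> real" where
  "revenue M \<alpha> x =
     measure_pmf.expectation (joining_pmf (sellers M) x) (\<lambda>P. \<alpha> * (\<Sum>j\<in>P. price M P j))"

text \<open>The supremum is taken in the extended reals, so it is meaningful without knowing in
  advance that the maximum over equilibria is attained.\<close>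

definition max_revenue :: "('b, 's) market \<Rightarrow> real \<Rightarrow> ereal" where
  "max_revenue M \<alpha> = (SUP x\<in>platform_equilibria M \<alpha>. ereal (revenue M \<alpha> x))"

definition revenue_maximizing_fee :: "('b, 's) market \<Rightarrow> real \<Rightarrow> bool" where
  "revenue_maximizing_fee M \<alpha> \<longleftrightarrow> is_arg_max (max_revenue M) (\<lambda>a. a \<in> {0..1}) \<alpha>"

definition revenue_maximizing_equilibria :: "('b, 's) market \<Rightarrow> real \<Rightarrow> ('s \<Rightarrow> real) set" where
  "revenue_maximizing_equilibria M \<alpha> =
     {x \<in> platform_equilibria M \<alpha>. ereal (revenue M \<alpha> x) = max_revenue M \<alpha>}"

definition expected_welfare :: "('b, 's) market \<Rightarrow> ('s \<Rightarrow> real) \<Rightarrow> real" where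
  "expected_welfare M x = measure_pmf.expectation (joining_pmf (sellers M) x) (welfare M)"

text \<open>The ratio is an extended real: an equilibrium of zero expected welfare has ratio
  \<open>\<infinity>\<close> if the optimal welfare is positive, rather than the ratio 0 of real division.\<close>

definition welfare_ratio :: "('b, 's) market \<Rightarrow> ('s \<Rightarrow> real) \<Rightarrow> ereal" where
  "welfare_ratio M x = ereal (optimal_welfare M) / ereal (expected_welfare M x)"

text \<open>\<open>r\<close> is the Price of Anarchy at the revenue-maximizing fee \<open>\<alpha>\<close>: the maximum exists
  and equals \<open>r\<close>.\<close>

definition has_price_of_anarchy :: "('b, 's) market \<Rightarrow> real \<Rightarrow> ereal \<Rightarrow> bool" where
  "has_price_of_anarchy M \<alpha> r \<longleftrightarrow>
     r \<in> welfare_ratio M ` revenue_maximizing_equilibria M \<alpha> \<and>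
     (\<forall>x\<in>revenue_maximizing_equilibria M \<alpha>. welfare_ratio M x \<le> r)"

end

(* Take the market without direct edges in which buyer i (counted from 0) has value 1/(i+1).
   If c sellers join, with 1 \<le> c \<le> n, each of them has price 1/c, so the prices of the joining
   sellers always sum to 1; they sum to 0 if c = 0 or c > n. Hence a fee below 1 earns less than 1.
   At fee 1 all utilities vanish, every profile is an equilibrium, and the profile in which exactly
   one seller joins earns the maximal revenue 1 at welfare 1. Every other revenue-maximizing
   equilibrium almost surely has a joining seller, hence welfare at least 1, while the optimal
   welfare is the harmonic number of min n m. *)

theory Submission
  imports Defs
begin

section \<open>Welfare and prices as harmonic numbers\<close>

definition harmonic_market :: "nat \<Rightarrow> nat \<Rightarrow> (nat, nat) market" where
  "harmonic_market n m =
     \<lparr>buyers = {..<n}, sellers = {..<m}, val = (\<lambda>i. inverse (real (Suc i))), edges = {}\<rparr>"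

lemma harmonic_market_simps [simp]:
  "buyers (harmonic_market n m) = {..<n}"
  "sellers (harmonic_market n m) = {..<m}"
  "val (harmonic_market n m) = (\<lambda>i. inverse (real (Suc i)))"
  "edges (harmonic_market n m) = {}"
  by (simp_all add: harmonic_market_def)

lemma homogeneous_harmonic_market: "homogeneous_market (harmonic_market n m)"
  by (simp add: homogeneous_market_def)

lemma harm_altdef_lessThan: "harm c = (\<Sum>i<c. inverse (real (Suc i)))"
  by (induction c) (simp_all add: harm_expand(1) harm_Suc)

text \<open>The values decrease, so the most valuable buyers are the first ones. By induction on the
  cardinality: the largest of \<open>Suc c\<close> indices is at least \<open>c\<close>, so its term
  is at most the last term of \<open>harm (Suc c)\<close>.\<close>

lemma sum_inverse_le_harm_card:
  assumes "finite I"
  shows "(\<Sum>i\<in>I. inverse (real (Suc i))) \<le> harm (card I)"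
  using assms
proof (induction "card I" arbitrary: I)
  case 0
  then show ?case by (simp add: harm_nonneg)
next
  case (Suc c)
  define k where "k = Max I"
  have ne: "I \<noteq> {}" using Suc.hyps(2) by auto
  have k: "k \<in> I" unfolding k_def using Suc.prems ne by simp
  have "I \<subseteq> {..k}" unfolding k_def using Suc.prems by auto
  \<comment> \<open>The set \<open>{..k}\<close> has \<open>Suc k\<close> elements and
    \<open>I\<close> has \<open>Suc c\<close>.\<close>
  from card_mono[OF _ this] have le: "c \<le> k" using Suc.hyps(2) by simp
  have card: "card (I - {k}) = c" using k Suc by simp
  have "(\<Sum>i\<in>I. inverse (real (Suc i))) =
        inverse (real (Suc k)) + (\<Sum>i\<in>I - {k}. inverse (real (Suc i)))"
    using k Suc.prems by (simp add: sum.remove)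
  also have "(\<Sum>i\<in>I - {k}. inverse (real (Suc i))) \<le> harm c"
    using Suc.hyps(1)[of "I - {k}"] card Suc.prems by simp
  also have "inverse (real (Suc k)) \<le> inverse (real (Suc c))"
    using le by (intro le_imp_inverse_le) auto
  finally show ?case
    using Suc.hyps(2)[symmetric] by (simp add: harm_Suc)
qed

text \<open>Assumption \<open>E\<close> makes the usable edges a complete bipartite graph between
  the buyers and \<open>Q\<close>. This form covers the complete graph, the platform graph and the
  platform graph with one seller deleted.\<close>

lemma max_welfare_harmonic_market:
  assumes Q: "finite Q" and E: "E \<inter> ({..<n} \<times> S) = {..<n} \<times> Q"
  shows "max_welfare (harmonic_market n m) S {..<n} E = harm (min n (card Q))"
  unfolding max_welfare_def harmonic_market_simps E
proof (rule Max_eqI)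
  have "{F. F \<subseteq> {..<n} \<times> Q \<and> is_matching F} \<subseteq> Pow ({..<n} \<times> Q)" by auto
  then show "finite ((\<lambda>F. \<Sum>e\<in>F. inverse (real (Suc (fst e)))) `
      {F. F \<subseteq> {..<n} \<times> Q \<and> is_matching F})"
    using Q by (meson finite_Pow_iff finite_SigmaI finite_imageI finite_lessThan finite_subset)
next
  fix w
  assume "w \<in> (\<lambda>F. \<Sum>e\<in>F. inverse (real (Suc (fst e)))) `
    {F. F \<subseteq> {..<n} \<times> Q \<and> is_matching F}"
  then obtain F where F: "F \<subseteq> {..<n} \<times> Q" and inj: "inj_on fst F" "inj_on snd F"
    and w: "w = (\<Sum>e\<in>F. inverse (real (Suc (fst e))))"
    by (auto simp: is_matching_def)
  have fin: "finite F" using F Q by (meson finite_SigmaI finite_lessThan finite_subset)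
  have "fst ` F \<subseteq> {..<n}" "snd ` F \<subseteq> Q" using F by auto
  then have "card F \<le> n" "card F \<le> card Q"
    using inj Q card_inj_on_le[of fst F "{..<n}"] card_inj_on_le[of snd F Q] by simp_all
  \<comment> \<open>No buyer is matched twice, so summing over edges is summing over a set of
    buyers.\<close>
  have "w = (\<Sum>i\<in>fst ` F. inverse (real (Suc i)))"
    by (simp add: w sum.reindex[OF inj(1)])
  also have "\<dots> \<le> harm (card (fst ` F))"
    using fin by (intro sum_inverse_le_harm_card) simp
  also have "\<dots> \<le> harm (min n (card Q))"
    using \<open>card F \<le> n\<close> \<open>card F \<le> card Q\<close> by (intro harm_mono) (simp add: card_image[OF inj(1)])
  finally show "w \<le> harm (min n (card Q))" .
next
  \<comment> \<open>The bound is attained by matching the first \<open>c\<close> buyers bijectively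
    to \<open>c\<close> sellers of \<open>Q\<close>.\<close>
  define c where "c = min n (card Q)"
  obtain T where T: "T \<subseteq> Q" "card T = c" "finite T"
    using obtain_subset_with_card_n[of c Q] unfolding c_def by auto
  obtain h where h: "bij_betw h {..<c} T"
    using ex_bij_betw_nat_finite[OF T(3)] T(2) by (auto simp: atLeast0LessThan)
  define F where "F = (\<lambda>i. (i, h i)) ` {..<c}"
  have "h i \<in> Q" if "i < c" for i
    using h that T(1) by (auto simp: bij_betw_def)
  then have "F \<subseteq> {..<n} \<times> Q"
    by (auto simp: F_def c_def)
  moreover have "is_matching F"
    using h by (auto simp: is_matching_def F_def bij_betw_def inj_on_def)
  moreover have "(\<Sum>e\<in>F. inverse (real (Suc (fst e)))) = harm c"
    unfolding F_def by (subst sum.reindex) (auto simp: inj_on_def harm_altdef_lessThan)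
  ultimately show "harm (min n (card Q)) \<in> (\<lambda>F. \<Sum>e\<in>F. inverse (real (Suc (fst e)))) `
      {F. F \<subseteq> {..<n} \<times> Q \<and> is_matching F}"
    by (auto simp: c_def intro!: image_eqI[of _ _ F])
qed

lemma optimal_welfare_harmonic_market:
  "optimal_welfare (harmonic_market n m) = harm (min n m)"
  unfolding optimal_welfare_def harmonic_market_simps
  by (subst max_welfare_harmonic_market[of "{..<m}"]) auto

lemma welfare_harmonic_market:
  assumes "P \<subseteq> {..<m}"
  shows "welfare (harmonic_market n m) P = harm (min n (card P))"
  unfolding welfare_def platform_edges_def harmonic_market_simps
  using assms by (intro max_welfare_harmonic_market) (auto intro: finite_subset)

text \<open>Without direct edges a seller outside \<open>P\<close> is isolated, so deleting
  \<open>j\<close> from the sellers acts as deleting it from \<open>P\<close>. For \<open>j\<close>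
  outside \<open>P\<close> the price is therefore 0.\<close>

lemma price_harmonic_market:
  assumes "P \<subseteq> {..<m}"
  shows "price (harmonic_market n m) P j = harm (min n (card P)) - harm (min n (card (P - {j})))"
proof -
  have "max_welfare (harmonic_market n m) ({..<m} - {j}) {..<n}
          ({} \<union> {..<n} \<times> P) = harm (min n (card (P - {j})))"
    using assms by (intro max_welfare_harmonic_market) (auto intro: finite_subset)
  then show ?thesis
    by (simp add: price_def platform_edges_def welfare_harmonic_market[OF assms])
qed

lemma sum_price_harmonic_market:
  assumes "P \<subseteq> {..<m}"
  shows "(\<Sum>j\<in>P. price (harmonic_market n m) P j) = (if card P \<in> {1..n} then 1 else 0)"
proof (cases "card P")
  case 0
  then show ?thesis using finite_subset[OF assms] by simp
next
  case (Suc c)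
  have "(\<Sum>j\<in>P. price (harmonic_market n m) P j) =
        (\<Sum>j\<in>P. harm (min n (Suc c)) - harm (min n c))"
    using Suc by (intro sum.cong) (auto simp: price_harmonic_market[OF assms])
  also have "\<dots> = real (Suc c) * (harm (min n (Suc c)) - harm (min n c))"
    using Suc by simp
  \<comment> \<open>If \<open>Suc c \<le> n\<close>, the difference is the reciprocal of the factor;
    otherwise both minima are \<open>n\<close>.\<close>
  also have "\<dots> = (if Suc c \<le> n then 1 else 0)"
    by (auto simp: harm_Suc min_def)
  finally show ?thesis using Suc by simp
qed

section \<open>The random set of joining sellers\<close>

lemma set_joining_pmf_subset: "finite A \<Longrightarrow> set_pmf (joining_pmf A x) \<subseteq> Pow A"
  using set_Pi_pmf_subset[of A False "\<lambda>j. bernoulli_pmf (x j)"]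
  by (auto simp: joining_pmf_def)

lemma integrable_joining_pmf:
  fixes f :: "'s set \<Rightarrow> real"
  assumes "finite A"
  shows "integrable (measure_pmf (joining_pmf A x)) f"
  by (rule integrable_measure_pmf_finite)
    (use set_joining_pmf_subset[OF assms] assms in \<open>auto intro: finite_subset\<close>)

lemma joining_pmf_indicator:
  assumes "finite A" "T \<subseteq> A" and x: "\<And>j. j \<in> A \<Longrightarrow> x j = of_bool (j \<in> T)"
  shows "joining_pmf A x = return_pmf T"
proof -
  have "Pi_pmf A False (\<lambda>j. bernoulli_pmf (x j)) = Pi_pmf A False (\<lambda>j. return_pmf (j \<in> T))"
  proof (rule Pi_pmf_cong)
    fix j assume "j \<in> A"
    then have "pmf (bernoulli_pmf (x j)) b = pmf (return_pmf (j \<in> T)) b" for b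
      by (cases b) (simp_all add: x)
    then show "bernoulli_pmf (x j) = return_pmf (j \<in> T)"
      by (rule pmf_eqI)
  qed simp_all
  \<comment> \<open>Sellers outside \<open>A\<close> get the default \<open>False\<close>, so
    \<open>T \<subseteq> A\<close> makes the resulting set exactly \<open>T\<close>.\<close>
  then show ?thesis
    using assms by (auto simp: joining_pmf_def map_return_pmf intro!: arg_cong[of _ _ return_pmf])
qed

section \<open>Revenue, equilibria and welfare at random profiles\<close>

lemma revenue_harmonic_market:
  "revenue (harmonic_market n m) \<alpha> x =
     measure_pmf.expectation (joining_pmf {..<m} x)
       (\<lambda>P. \<alpha> * (if card P \<in> {1..n} then 1 else 0))"
  unfolding revenue_def harmonic_market_simps
\<comment> \<open>The price sum is known only for subsets of the sellers, which carry all the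
  mass.\<close>
proof (rule integral_cong_AE)
  show "AE P in measure_pmf (joining_pmf {..<m} x).
      \<alpha> * (\<Sum>j\<in>P. price (harmonic_market n m) P j) =
      \<alpha> * (if card P \<in> {1..n} then 1 else 0)"
    using set_joining_pmf_subset[of "{..<m}" x]
    by (auto simp: AE_measure_pmf_iff sum_price_harmonic_market)
qed simp_all

lemma revenue_harmonic_market_le:
  assumes "0 \<le> \<alpha>"
  shows "revenue (harmonic_market n m) \<alpha> x \<le> \<alpha>"
  unfolding revenue_harmonic_market using assms
  by (intro measure_pmf.integral_le_const integrable_joining_pmf) (auto simp: AE_measure_pmf_iff)

text \<open>The shortfall \<open>?g\<close> is nonnegative with expectation 0, so it vanishes on the
  whole support.\<close>

lemma revenue_harmonic_market_eq_1D:
  assumes "revenue (harmonic_market n m) 1 x = 1" and P: "P \<in> set_pmf (joining_pmf {..<m} x)"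
  shows "card P \<in> {1..n}"
proof -
  let ?g = "\<lambda>P::nat set. 1 - (if card P \<in> {1..n} then 1 else 0 :: real)"
  have "measure_pmf.expectation (joining_pmf {..<m} x) ?g = 0"
    using assms(1) by (subst Bochner_Integration.integral_diff)
      (auto simp: revenue_harmonic_market intro: integrable_joining_pmf)
  then have "AE P in measure_pmf (joining_pmf {..<m} x). ?g P = 0"
    by (subst (asm) integral_nonneg_eq_0_iff_AE) (auto intro: integrable_joining_pmf)
  with P show ?thesis by (auto simp: AE_measure_pmf_iff split: if_splits)
qed

text \<open>A joining seller pays its entire price as fee; a seller who stays out has price
  0.\<close>

lemma utility_harmonic_market_1:
  assumes "P \<subseteq> {..<m}"
  shows "utility (harmonic_market n m) 1 j P = 0"
  using assms by (simp add: utility_def price_harmonic_market)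

lemma platform_equilibria_harmonic_market_1:
  "platform_equilibria (harmonic_market n m) 1 = {..<m} \<rightarrow>\<^sub>E {0..1}"
proof -
  have zero: "measure_pmf.expectation (joining_pmf A x) f = 0"
    if "finite A" "\<And>P. P \<subseteq> A \<Longrightarrow> f P = 0" for A :: "nat set" and x and f :: "nat set \<Rightarrow> real"
    using that set_joining_pmf_subset[of A x]
    by (intro integral_eq_zero_AE) (auto simp: AE_measure_pmf_iff)
  have "measure_pmf.expectation (joining_pmf {..<m} x) (utility (harmonic_market n m) 1 j) = 0"
       "measure_pmf.expectation (joining_pmf ({..<m} - {j}) x)
          (utility (harmonic_market n m) 1 j) = 0"
       "measure_pmf.expectation (joining_pmf ({..<m} - {j}) x)
          (\<lambda>P. utility (harmonic_market n m) 1 j (insert j P)) = 0"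
    if "j < m" for x j
    using that by (auto intro!: zero utility_harmonic_market_1)
  then show ?thesis by (auto simp: platform_equilibria_def)
qed

lemma expected_welfare_harmonic_market_ge_1:
  assumes "revenue (harmonic_market n m) 1 x = 1"
  shows "1 \<le> expected_welfare (harmonic_market n m) x"
  unfolding expected_welfare_def harmonic_market_simps
proof (rule measure_pmf.integral_ge_const)
  show "AE P in measure_pmf (joining_pmf {..<m} x). 1 \<le> welfare (harmonic_market n m) P"
    unfolding AE_measure_pmf_iff
  proof
    fix P assume P: "P \<in> set_pmf (joining_pmf {..<m} x)"
    have "harm 1 \<le> (harm (min n (card P)) :: real)"
      using revenue_harmonic_market_eq_1D[OF assms P] by (intro harm_mono) simp
    moreover have "P \<subseteq> {..<m}"
      using P set_joining_pmf_subset[of "{..<m}" x] by auto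
    ultimately show "1 \<le> welfare (harmonic_market n m) P"
      by (simp add: welfare_harmonic_market harm_def)
  qed
qed (rule integrable_joining_pmf, simp)

section \<open>The single-seller profile and the Price of Anarchy\<close>

context
  fixes n m :: nat and x1 :: "nat \<Rightarrow> real"
  assumes n: "1 \<le> n" and m: "1 \<le> m"
  \<comment> \<open>Seller 0 joins surely and nobody else does. The restriction is there because
    profiles are extensional functions on the sellers.\<close>
  defines "x1 \<equiv> restrict (\<lambda>j. of_bool (j \<in> {0})) {..<m}"
begin

lemma joining_pmf_single: "joining_pmf {..<m} x1 = return_pmf {0}"
  using m by (intro joining_pmf_indicator) (auto simp: x1_def)

lemma revenue_single: "revenue (harmonic_market n m) \<alpha> x1 = \<alpha>"
  using n by (simp add: revenue_harmonic_market joining_pmf_single)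

lemma expected_welfare_single: "expected_welfare (harmonic_market n m) x1 = 1"
proof -
  have "min n (card {0::nat}) = 1" using n by simp
  then show ?thesis
    using m by (simp add: expected_welfare_def joining_pmf_single welfare_harmonic_market harm_def)
qed

lemma single_equilibrium: "x1 \<in> platform_equilibria (harmonic_market n m) 1"
  by (auto simp: platform_equilibria_harmonic_market_1 x1_def)

text \<open>This upper bound spares computing equilibria at fees below 1. It also covers an empty
  set of equilibria, whose supremum is \<open>-\<infinity>\<close>.\<close>

lemma max_revenue_harmonic_market_le:
  assumes "0 \<le> \<alpha>"
  shows "max_revenue (harmonic_market n m) \<alpha> \<le> ereal \<alpha>"
  unfolding max_revenue_def using revenue_harmonic_market_le[OF assms] by (auto intro: SUP_least)

lemma max_revenue_harmonic_market_1: "max_revenue (harmonic_market n m) 1 = 1"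
proof (rule antisym)
  show "max_revenue (harmonic_market n m) 1 \<le> 1"
    using max_revenue_harmonic_market_le[of 1] by (simp add: one_ereal_def)
  show "1 \<le> max_revenue (harmonic_market n m) 1"
    unfolding max_revenue_def
    using single_equilibrium by (intro SUP_upper2[of x1]) (simp_all add: revenue_single one_ereal_def)
qed

lemma revenue_maximizing_fee_harmonic_market:
  "revenue_maximizing_fee (harmonic_market n m) \<alpha> \<longleftrightarrow> \<alpha> = 1"
proof -
  have less: "max_revenue (harmonic_market n m) \<beta> < max_revenue (harmonic_market n m) 1"
    if "0 \<le> \<beta>" "\<beta> < 1" for \<beta>
    using max_revenue_harmonic_market_le[OF that(1)] that(2)
    by (simp add: max_revenue_harmonic_market_1 one_ereal_def le_less_trans)
  show ?thesis
  proof
    assume "revenue_maximizing_fee (harmonic_market n m) \<alpha>"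
    then show "\<alpha> = 1"
      using less[of \<alpha>] unfolding revenue_maximizing_fee_def is_arg_max_def by force
  next
    assume "\<alpha> = 1"
    then show "revenue_maximizing_fee (harmonic_market n m) \<alpha>"
      using less unfolding revenue_maximizing_fee_def is_arg_max_def
      by (metis atLeastAtMost_iff less_asym less_irrefl order_le_less zero_le_one)
  qed
qed

lemma has_price_of_anarchy_harmonic_market:
  "has_price_of_anarchy (harmonic_market n m) 1 (ereal (harm (min n m)))"
  unfolding has_price_of_anarchy_def
proof (intro conjI ballI)
  have "x1 \<in> revenue_maximizing_equilibria (harmonic_market n m) 1"
    using single_equilibrium
    by (simp add: revenue_maximizing_equilibria_def revenue_single max_revenue_harmonic_market_1
        one_ereal_def)
  moreover have "welfare_ratio (harmonic_market n m) x1 = ereal (harm (min n m))"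
    by (simp add: welfare_ratio_def optimal_welfare_harmonic_market expected_welfare_single)
  ultimately show "ereal (harm (min n m)) \<in> welfare_ratio (harmonic_market n m) `
      revenue_maximizing_equilibria (harmonic_market n m) 1"
    by (metis image_eqI)
next
  fix x assume "x \<in> revenue_maximizing_equilibria (harmonic_market n m) 1"
  then have "revenue (harmonic_market n m) 1 x = 1"
    by (simp add: revenue_maximizing_equilibria_def max_revenue_harmonic_market_1 one_ereal_def)
  then have ge: "1 \<le> expected_welfare (harmonic_market n m) x"
    by (rule expected_welfare_harmonic_market_ge_1)
  \<comment> \<open>Welfare at least 1 keeps the denominator positive, so the extended-real ratio is
    the real quotient.\<close>
  have "harm (min n m) / expected_welfare (harmonic_market n m) x \<le> harm (min n m) / 1"
    using ge by (intro divide_left_mono) (auto simp: harm_nonneg)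
  then show "welfare_ratio (harmonic_market n m) x \<le> ereal (harm (min n m))"
    using ge by (simp add: welfare_ratio_def optimal_welfare_harmonic_market)
qed

end

section \<open>Logarithmic growth of the harmonic numbers\<close>

lemma harm_bigomega_ln: "(\<lambda>k. harm k :: real) \<in> \<Omega>(\<lambda>k. ln (real k))"
proof (rule landau_omega.bigI[of 1])
  show "\<forall>\<^sub>F k in at_top. norm (harm k :: real) \<ge> 1 * norm (ln (real k))"
    using eventually_gt_at_top[of 0]
  proof eventually_elim
    case (elim k)
    have "ln (real k) \<le> ln (real k + 1)" using elim by simp
    also have "\<dots> \<le> harm k" by (rule ln_le_harm)
    finally show ?case using elim by (simp add: harm_nonneg)
  qed
qed simp

theorem theorem4p4:
  shows "(\<forall>n\<ge>1. \<forall>m\<ge>1. \<exists>M :: (nat, nat) market.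
            homogeneous_market M \<and> card (buyers M) = n \<and> card (sellers M) = m \<and>
            (\<exists>\<alpha>. revenue_maximizing_fee M \<alpha>) \<and>
            (\<forall>\<alpha>. revenue_maximizing_fee M \<alpha> \<longrightarrow>
               has_price_of_anarchy M \<alpha> (ereal (harm (min n m))))) \<and>
         (\<lambda>k. harm k :: real) \<in> \<Omega>(\<lambda>k. ln (real k))"
proof (intro conjI allI impI)
  fix n m :: nat
  assume "1 \<le> n" "1 \<le> m"
  then show "\<exists>M :: (nat, nat) market.
            homogeneous_market M \<and> card (buyers M) = n \<and> card (sellers M) = m \<and>
            (\<exists>\<alpha>. revenue_maximizing_fee M \<alpha>) \<and>
            (\<forall>\<alpha>. revenue_maximizing_fee M \<alpha> \<longrightarrow>
               has_price_of_anarchy M \<alpha> (ereal (harm (min n m))))"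
    \<comment> \<open>Since 1 is the only revenue-maximizing fee, both claims about fees reduce to
      it.\<close>
    by (intro exI[of _ "harmonic_market n m"])
      (simp add: homogeneous_harmonic_market revenue_maximizing_fee_harmonic_market
        has_price_of_anarchy_harmonic_market)
qed (rule harm_bigomega_ln)

end
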